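(* For every integer $n\geq 1$ and every $k\in\{0,1,\ldots,n\}$ let $f_n(k):=P\left(|B(n,k/n)-k|\leq \sqrt{\mathrm{Var}(B(n,k/n))}\right)$. Then for any fixed positive integer $n$, $$\min_{k=0,1,\ldots,n} f_n(k)=f_n(1)=f_n(n-1)=\begin{cases}1, & \text{if } n=1,\\ \left(\frac{n-1}{n}\right)^{n-1}, & \text{if } n\geq 2.\end{cases}$$
   Context: $B(n,p)$ denotes a binomial random variable with parameters $n$ (number of trials) and $p\in[0,1]$ (success probability), i.e. $P(B(n,p)=i)=\binom{n}{i}p^i(1-p)^{n-i}$ for $i=0,1,\ldots,n$ (with the convention $0^0=1$). $\mathrm{Var}(\cdot)$ denotes the variance, so $\mathrm{Var}(B(n,k/n))=\frac{k(n-k)}{n}$. *)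

theory Defs
  imports "HOL-Probability.Probability"
begin

definition one_sd_prob :: "nat \<Rightarrow> nat \<Rightarrow> real" where
  "one_sd_prob n k =
     measure_pmf.prob (binomial_pmf n (real k / real n))
       {i. \<bar>real i - real k\<bar>
             \<le> sqrt (measure_pmf.variance (binomial_pmf n (real k / real n)) real)}"

end

theory Submission
  imports Defs
begin

text \<open>
  If \<open>0 < k < n\<close> and the variance \<open>V = k (n - k) / n\<close> is below 1, which happens exactly for
  \<open>k = 1\<close> and \<open>k = n - 1\<close>, then \<open>f\<^sub>n(k)\<close> is the single probability \<open>P(B = k)\<close>. For
  \<open>2 \<le> k \<le> n - 2\<close> the distribution is unimodal with mode equal to its mean \<open>k\<close>, so a discrete
  form of Gauss's inequality applies: \<open>P(|B - k| \<le> m) \<ge> (2m + 1) / T\<close> whenever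
  \<open>T\<^sup>2 \<ge> 1 + 12 V\<close> and \<open>T \<ge> 3 (2m + 1) / 2\<close>. With \<open>m = \<lfloor>\<surd>V\<rfloor> \<ge> 1\<close> one may take
  \<open>T = 7 (2m + 1) / 3\<close> (the tight case being \<open>m = 1\<close>, \<open>V \<rightarrow> 4\<close>), so that \<open>f\<^sub>n(k) \<ge> 3/7\<close>,
  while \<open>((n - 1) / n)\<^bsup>n - 1\<^esup> \<le> 3/7\<close> as soon as \<open>n \<ge> 4\<close>.
\<close>

section \<open>Summation tools\<close>

text \<open>Abel summation gives the stronger bound \<open>a N * (\<Sum>i\<le>N. c i)\<close>, which is what the induction needs.\<close>

lemma sum_antimono_mult_nonneg:
  fixes a c :: "nat \<Rightarrow> real"
  assumes "\<And>i. i < N \<Longrightarrow> a (Suc i) \<le> a i" and "0 \<le> a N"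
    and "\<And>l. l \<le> N \<Longrightarrow> 0 \<le> (\<Sum>i\<le>l. c i)"
  shows "0 \<le> (\<Sum>i\<le>N. a i * c i)"
proof -
  have "a N * (\<Sum>i\<le>N. c i) \<le> (\<Sum>i\<le>N. a i * c i)"
    using assms(1,3)
  proof (induction N)
    case 0
    then show ?case by simp
  next
    case (Suc N)
    have "a (Suc N) * (\<Sum>i\<le>N. c i) \<le> a N * (\<Sum>i\<le>N. c i)"
      using Suc.prems by (intro mult_right_mono) auto
    also have "\<dots> \<le> (\<Sum>i\<le>N. a i * c i)"
      using Suc.prems by (intro Suc.IH) auto
    finally show ?case
      by (simp add: distrib_left)
  qed
  moreover have "0 \<le> a N * (\<Sum>i\<le>N. c i)"
    using assms by simp
  ultimately show ?thesis by simp
qed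

text \<open>The central term lies in both halves, hence the subtraction; it matches halving the
  central weight on either side of the mode.\<close>

lemma sum_atMost_split_at:
  fixes f :: "nat \<Rightarrow> real"
  assumes "k \<le> n"
  shows "(\<Sum>i\<le>n. f i) = (\<Sum>j\<le>n - k. f (k + j)) + (\<Sum>j\<le>k. f (k - j)) - f k"
proof -
  have "(\<Sum>i\<le>n. f i) = (\<Sum>i<k. f i) + (\<Sum>i=k..n. f i)"
    using sum.atLeastLessThan_concat[of 0 k "Suc n" f] assms
    by (simp add: atLeast0LessThan atMost_atLeast0 atLeastLessThanSuc_atLeastAtMost)
  moreover have "(\<Sum>i=k..n. f i) = (\<Sum>j\<le>n - k. f (k + j))"
    using sum.shift_bounds_cl_nat_ivl[of f 0 k "n - k"] assms
    by (simp add: atMost_atLeast0 add.commute)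
  moreover have "(\<Sum>j\<le>k. f (k - j)) = (\<Sum>j\<le>k. f j)"
    by (simp add: sum.nat_diff_reindex atMost_atLeast0 sum.atLeastAtMost_rev[of f 0 k])
  moreover have "(\<Sum>j\<le>k. f j) = (\<Sum>i<k. f i) + f k"
    by (simp add: lessThan_Suc_atMost[symmetric])
  ultimately show ?thesis by simp
qed

section \<open>The discrete Gauss inequality\<close>

text \<open>
  The dual certificate of the discrete Gauss inequality. Put \<open>M = 2m + 1\<close> and \<open>t = 2l + 1\<close>. As
  \<open>\<Sum>\<^bsub>|j| \<le> l\<^esub> (1 + 12 j\<^sup>2) = t\<^sup>3\<close>, the symmetric sum of the weights over \<open>|j| \<le> l\<close> is
  \<open>min t M - 3 M t / (2 T) + M t\<^sup>3 / (2 T\<^sup>3)\<close>. For \<open>t \<ge> M\<close> this is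
  \<open>M (y - 1)\<^sup>2 (y + 2) / 2\<close> with \<open>y = t / T\<close>: after division by \<open>t\<close>, the convex function
  \<open>M / t\<close> of \<open>t\<^sup>2\<close> lies above its tangent at \<open>T\<^sup>2\<close>.
\<close>

definition gauss_weight :: "nat \<Rightarrow> real \<Rightarrow> nat \<Rightarrow> real" where
  "gauss_weight m T j = of_bool (j \<le> m) - 3 * real (2 * m + 1) / (2 * T)
     + real (2 * m + 1) * (1 + 12 * (real j)\<^sup>2) / (2 * T ^ 3)"

lemma sum_gauss_weight:
  "2 * (\<Sum>j\<le>l. gauss_weight m T j) - gauss_weight m T 0 =
     real (min (2 * l + 1) (2 * m + 1)) - 3 * real (2 * m + 1) * real (2 * l + 1) / (2 * T)
     + real (2 * m + 1) * real (2 * l + 1) ^ 3 / (2 * T ^ 3)"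
proof -
  define A B where "A = 3 * real (2 * m + 1) / (2 * T)" and "B = real (2 * m + 1) / (2 * T ^ 3)"
  have w: "gauss_weight m T j = of_bool (j \<le> m) - A + B * (1 + 12 * (real j)\<^sup>2)" for j
    by (simp add: gauss_weight_def A_def B_def)
  have "2 * (\<Sum>j\<le>l. gauss_weight m T j) - gauss_weight m T 0 =
      real (min (2 * l + 1) (2 * m + 1)) - A * real (2 * l + 1) + B * real (2 * l + 1) ^ 3"
  proof (induction l)
    case 0
    then show ?case by (simp add: w)
  next
    case (Suc l)
    have *: "real (min (2 * Suc l + 1) (2 * m + 1)) =
        real (min (2 * l + 1) (2 * m + 1)) + 2 * of_bool (Suc l \<le> m)"
      by (auto simp: min_def)
    have "2 * (\<Sum>j\<le>Suc l. gauss_weight m T j) - gauss_weight m T 0 =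
        2 * (\<Sum>j\<le>l. gauss_weight m T j) - gauss_weight m T 0 + 2 * gauss_weight m T (Suc l)"
      by simp
    also have "\<dots> = real (min (2 * Suc l + 1) (2 * m + 1))
        - A * real (2 * Suc l + 1) + B * real (2 * Suc l + 1) ^ 3"
      unfolding Suc.IH * unfolding w by (simp add: algebra_simps power2_eq_square power3_eq_cube)
    finally show ?case .
  qed
  then show ?thesis by (simp add: A_def B_def)
qed

lemma sum_gauss_weight_nonneg:
  assumes T: "3 * real (2 * m + 1) \<le> 2 * T"
  shows "0 \<le> 2 * (\<Sum>j\<le>l. gauss_weight m T j) - gauss_weight m T 0"
proof -
  define M t where "M = real (2 * m + 1)" and "t = real (2 * l + 1)"
  have pos: "M > 0" "t > 0" "T > 0"
    using T by (auto simp: M_def t_def)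
  have T': "3 * M \<le> 2 * T"
    using T by (simp only: M_def)
  have "0 \<le> min t M - 3 * M * t / (2 * T) + M * t ^ 3 / (2 * T ^ 3)"
  proof (cases "t \<le> M")
    case True
    \<comment> \<open>Only here is the lower bound on \<open>T\<close> needed: the linear term is at
      most \<open>t = min t M\<close>, and the cubic term is nonnegative.\<close>
    have "3 * M * t / (2 * T) \<le> t"
      using T' pos by (simp add: field_simps)
    with True pos show ?thesis by (simp add: min_def)
  next
    case False
    define y where "y = t / T"
    have "0 \<le> M * ((y - 1)\<^sup>2 * (y + 2) / 2)"
      using pos by (simp add: y_def)
    also have "\<dots> = M - 3 * M * y / 2 + M * y ^ 3 / 2"
      by (simp add: field_simps power2_eq_square power3_eq_cube)
    finally show ?thesis
      using False by (simp add: y_def min_def power_divide)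
  qed
  then show ?thesis
    unfolding sum_gauss_weight by (simp add: M_def t_def of_nat_min)
qed

text \<open>
  Summation by parts is applied on each side of the mode \<open>k\<close>, with half of the central weight
  assigned to either side.
\<close>

lemma discrete_gauss_inequality:
  fixes p :: "nat \<Rightarrow> real"
  assumes "k \<le> n" and nonneg: "\<And>i. 0 \<le> p i" and total: "(\<Sum>i\<le>n. p i) = 1"
    and incr: "\<And>i. i < k \<Longrightarrow> p i \<le> p (Suc i)"
    and decr: "\<And>i. k \<le> i \<Longrightarrow> i < n \<Longrightarrow> p (Suc i) \<le> p i"
    and T: "3 * real (2 * m + 1) \<le> 2 * T"
    and var: "1 + 12 * (\<Sum>i\<le>n. (real i - real k)\<^sup>2 * p i) \<le> T\<^sup>2"
  shows "real (2 * m + 1) / T \<le> (\<Sum>i\<le>n. of_bool (\<bar>real i - real k\<bar> \<le> real m) * p i)"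
proof -
  define M where "M = real (2 * m + 1)"
  define S where "S = (\<Sum>i\<le>n. of_bool (\<bar>real i - real k\<bar> \<le> real m) * p i)"
  define V where "V = (\<Sum>i\<le>n. (real i - real k)\<^sup>2 * p i)"
  define w where "w i = of_bool (\<bar>real i - real k\<bar> \<le> real m) - 3 * M / (2 * T)
     + M * (1 + 12 * (real i - real k)\<^sup>2) / (2 * T ^ 3)" for i
  define c where "c j = (if j = 0 then gauss_weight m T 0 / 2 else gauss_weight m T j)" for j
  have pos: "M > 0" "T > 0"
    using T by (auto simp: M_def)
  have c_sum: "0 \<le> (\<Sum>j\<le>l. c j)" for l
  proof -
    have "(\<Sum>j\<le>l. c j) = (\<Sum>j\<le>l. gauss_weight m T j) - gauss_weight m T 0 / 2"
      by (induction l) (auto simp: c_def)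
    then show ?thesis
      using sum_gauss_weight_nonneg[OF T, of l] by simp
  qed
  have w_right: "w (k + j) = gauss_weight m T j" for j
    by (simp add: w_def gauss_weight_def M_def)
  have w_left: "w (k - j) = gauss_weight m T j" if "j \<le> k" for j
    using that by (simp add: w_def gauss_weight_def M_def of_nat_diff)
  have "0 \<le> (\<Sum>j\<le>n - k. p (k + j) * c j)"
    using nonneg decr c_sum by (intro sum_antimono_mult_nonneg) auto
  moreover have "(\<Sum>j\<le>n - k. p (k + j) * c j) = (\<Sum>j\<le>n - k. p (k + j) * w (k + j)) - p k * w k / 2"
    using w_right[of 0] by (simp add: w_right c_def sum.atMost_shift)
  moreover have "0 \<le> (\<Sum>j\<le>k. p (k - j) * c j)"
  proof (rule sum_antimono_mult_nonneg)
    show "p (k - Suc i) \<le> p (k - i)" if "i < k" for i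
      using incr[of "k - Suc i"] that by (simp add: Suc_diff_Suc)
  qed (use nonneg c_sum in auto)
  moreover have "(\<Sum>j\<le>k. p (k - j) * c j) = (\<Sum>j\<le>k. p (k - j) * w (k - j)) - p k * w k / 2"
    using w_right[of 0] by (simp add: w_left c_def sum.atMost_shift)
  ultimately have "0 \<le> (\<Sum>i\<le>n. p i * w i)"
    using sum_atMost_split_at[OF \<open>k \<le> n\<close>, of "\<lambda>i. p i * w i"] by simp
  also have "(\<Sum>i\<le>n. p i * w i) = S - 3 * M / (2 * T) + M / (2 * T ^ 3) * (1 + 12 * V)"
  proof -
    define A B where "A = 3 * M / (2 * T)" and "B = M / (2 * T ^ 3)"
    have "(\<Sum>i\<le>n. p i * w i) = (\<Sum>i\<le>n. of_bool (\<bar>real i - real k\<bar> \<le> real m) * p i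
        + (B - A) * p i + 12 * B * ((real i - real k)\<^sup>2 * p i))"
      by (intro sum.cong) (auto simp: w_def A_def B_def algebra_simps add_divide_distrib)
    also have "\<dots> = S + (B - A) * 1 + 12 * B * V"
      unfolding S_def V_def total[symmetric] by (simp only: sum.distrib sum_distrib_left)
    finally show ?thesis
      unfolding A_def[symmetric] B_def[symmetric] by (simp add: algebra_simps)
  qed
  \<comment> \<open>With \<open>T\<^sup>2\<close> in place of \<open>1 + 12 * V\<close>, the last
    term becomes \<open>M / (2 * T)\<close>, so the total loss is exactly
    \<open>M / T\<close>.\<close>
  also have "\<dots> \<le> S - 3 * M / (2 * T) + M / (2 * T ^ 3) * T\<^sup>2"
    using var pos by (intro add_left_mono mult_left_mono) (auto simp: V_def)
  also have "\<dots> = S - M / T"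
    using pos by (simp add: field_simps power2_eq_square power3_eq_cube)
  finally show ?thesis by (simp add: M_def S_def)
qed

section \<open>Binomial moments through Bernstein polynomials\<close>

lemma expectation_binomial_Bernstein:
  fixes f :: "nat \<Rightarrow> real"
  assumes "0 \<le> p" "p \<le> 1"
  shows "measure_pmf.expectation (binomial_pmf n p) f = (\<Sum>i\<le>n. f i * Bernstein n i p)"
  using expectation_binomial_pmf'[of p n f] assms by (simp add: Bernstein_def mult_ac)

lemma Bernstein_second_central_moment:
  "(\<Sum>i\<le>n. (real i - real n * p)\<^sup>2 * Bernstein n i p) = real n * p * (1 - p)"
proof -
  \<comment> \<open>The square is rewritten through \<open>i * (i - 1)\<close> and \<open>i\<close>,
    whose Bernstein sums are known.\<close>
  have "(\<Sum>i\<le>n. (real i - real n * p)\<^sup>2 * Bernstein n i p) =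
    (\<Sum>i\<le>n. real i * (real i - 1) * Bernstein n i p
      + (1 - 2 * real n * p) * (real i * Bernstein n i p) + (real n * p)\<^sup>2 * Bernstein n i p)"
    by (intro sum.cong) (auto simp: algebra_simps power2_eq_square)
  also have "\<dots> = real n * (real n - 1) * p\<^sup>2 + (1 - 2 * real n * p) * (real n * p) + (real n * p)\<^sup>2"
    by (simp add: sum.distrib sum_distrib_left[symmetric])
  also have "\<dots> = real n * p * (1 - p)"
    by (simp add: algebra_simps power2_eq_square)
  finally show ?thesis .
qed

lemma variance_binomial_pmf:
  assumes "0 \<le> p" "p \<le> 1"
  shows "measure_pmf.variance (binomial_pmf n p) real = real n * p * (1 - p)"
  using assms by (simp add: expectation_binomial_Bernstein Bernstein_second_central_moment)

lemma one_sd_prob_eq: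
  assumes "n \<ge> 1" "k \<le> n"
  shows "one_sd_prob n k = (\<Sum>i\<le>n. of_bool (\<bar>real i - real k\<bar> \<le> sqrt (real k * (1 - real k / real n)))
           * Bernstein n i (real k / real n))"
proof -
  have p: "0 \<le> real k / real n" "real k / real n \<le> 1"
    using assms by auto
  have "one_sd_prob n k = measure_pmf.expectation (binomial_pmf n (real k / real n))
      (indicator {i. \<bar>real i - real k\<bar> \<le> sqrt (real k * (1 - real k / real n))})"
    using assms by (simp add: one_sd_prob_def variance_binomial_pmf[OF p])
  also have "\<dots> = (\<Sum>i\<le>n. of_bool (\<bar>real i - real k\<bar> \<le> sqrt (real k * (1 - real k / real n)))
           * Bernstein n i (real k / real n))"
    unfolding expectation_binomial_Bernstein[OF p] by (intro sum.cong) (auto simp: indicator_def)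
  finally show ?thesis .
qed

section \<open>Exact values at the ends and for small variance\<close>

lemma one_sd_prob_0: "one_sd_prob n 0 = 1"
  by (simp add: one_sd_prob_def measure_pmf.prob_eq_1 AE_measure_pmf_iff)

lemma one_sd_prob_self: "n \<ge> 1 \<Longrightarrow> one_sd_prob n n = 1"
  by (simp add: one_sd_prob_def measure_pmf.prob_eq_1 AE_measure_pmf_iff)

text \<open>The variance \<open>k * (n - k) / n\<close> is below 1, so the window around the integer
  \<open>k\<close> contains no other integer.\<close>

lemma one_sd_prob_variance_less_1:
  assumes "0 < k" "k \<le> n" and "k * (n - k) < n"
  shows "one_sd_prob n k = Bernstein n k (real k / real n)"
proof -
  define s where "s = sqrt (real k * (1 - real k / real n))"
  have "real k * (real n - real k) < real n"
    using assms by (metis of_nat_diff of_nat_less_iff of_nat_mult)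
  then have "real k * (1 - real k / real n) < 1"
    using assms by (simp add: field_simps)
  then have s: "s < 1"
    by (simp add: s_def)
  have s0: "0 \<le> s" using assms by (simp add: s_def)
  have "\<bar>real i - real k\<bar> \<le> s \<longleftrightarrow> i = k" for i
    using s s0 by (cases i k rule: linorder_cases) auto
  then have "one_sd_prob n k = (\<Sum>i\<le>n. of_bool (i = k) * Bernstein n i (real k / real n))"
    using assms by (simp add: one_sd_prob_eq s_def)
  also have "\<dots> = (\<Sum>i\<le>n. if i = k then Bernstein n i (real k / real n) else 0)"
    by (intro sum.cong) auto
  finally show ?thesis
    using assms by simp
qed

section \<open>Unimodality and the middle range\<close>

lemma Bernstein_Suc_eq:
  assumes "i < n"
  shows "real (Suc i) * (1 - p) * Bernstein n (Suc i) p = real (n - i) * p * Bernstein n i p"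
proof -
  have "real (Suc i) * real (n choose Suc i) = real (n - i) * real (n choose i)"
    using binomial_absorb_comp[of n i] binomial_absorption[of i n]
    by (metis of_nat_mult)
  moreover have "(1 - p) ^ (n - i) = (1 - p) * (1 - p) ^ (n - Suc i)"
    using assms by (metis Suc_diff_Suc power_Suc)
  ultimately show ?thesis
    by (simp add: Bernstein_def mult_ac)
qed

lemma Bernstein_unimodal:
  assumes "0 < k" "k < n" "i < n"
  shows "i < k \<Longrightarrow> Bernstein n i (real k / real n) \<le> Bernstein n (Suc i) (real k / real n)"
    and "k \<le> i \<Longrightarrow> Bernstein n (Suc i) (real k / real n) \<le> Bernstein n i (real k / real n)"
proof -
  define p where "p = real k / real n"
  have p: "0 < p" "p < 1"
    using assms by (auto simp: p_def)
  define a b where "a = Bernstein n i p" and "b = Bernstein n (Suc i) p"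
  have ab: "0 < a" "0 \<le> b"
    using p assms by (auto simp: a_def b_def Bernstein_pos Bernstein_nonneg)
  define u v where "u = real (Suc i) * (1 - p)" and "v = real (n - i) * p"
  have uv: "0 < u" "0 < v" "u * b = v * a"
    using p assms Bernstein_Suc_eq[of i n p] by (auto simp: u_def v_def a_def b_def)
  \<comment> \<open>As \<open>0 < p < 1\<close>, the sign is positive for \<open>i < k\<close> and
    negative for \<open>k \<le> i\<close>.\<close>
  have diff: "v - u = real k + p - real (Suc i)"
    using assms by (simp add: u_def v_def p_def of_nat_diff field_simps)
  show "a \<le> b" if "i < k"
  proof -
    have "u \<le> v" using diff that p by simp
    then have "u * a \<le> u * b" unfolding uv(3) using ab by (simp add: mult_right_mono)
    then show ?thesis using uv(1) by simp
  qed
  show "b \<le> a" if "k \<le> i"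
  proof -
    have "v \<le> u" using diff that p by simp
    then have "u * b \<le> u * a" unfolding uv(3) using ab by (simp add: mult_right_mono)
    then show ?thesis using uv(1) by simp
  qed
qed

lemma one_sd_prob_ge:
  assumes k: "2 \<le> k" "k + 2 \<le> n"
  shows "3 / 7 \<le> one_sd_prob n k"
proof -
  define p V where "p = real k / real n" and "V = real k * (1 - p)"
  \<comment> \<open>Expanded, this says \<open>k * (n - k) \<ge> n\<close>, that is,
    \<open>V \<ge> 1\<close>.\<close>
  have "1 * 1 \<le> (real k - 1) * (real n - real k - 1)"
    using k by (intro mult_mono) auto
  then have V1: "1 \<le> V"
    using k by (simp add: V_def p_def field_simps)
  define m where "m = nat \<lfloor>sqrt V\<rfloor>"
  have m: "real m \<le> sqrt V" "sqrt V < real m + 1"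
    using V1 by (auto simp: m_def)
  have "1 \<le> m"
    using V1 by (simp add: m_def le_nat_iff le_floor_iff)
  have "V < (real m + 1)\<^sup>2"
    using power_strict_mono[OF m(2), of 2] V1 by simp
  \<comment> \<open>The product is 9 times the gap between
    \<open>(7 / 3 * (2 * m + 1))\<^sup>2\<close> and \<open>1 + 12 * (m + 1)\<^sup>2\<close>. It
    vanishes at \<open>m = 1\<close>, which fixes the constant 7/3.\<close>
  moreover have "0 \<le> (real m - 1) * (88 * real m + 68)"
    using \<open>1 \<le> m\<close> by simp
  ultimately have V: "1 + 12 * V \<le> (7 / 3 * real (2 * m + 1))\<^sup>2"
    by (simp add: power2_eq_square algebra_simps)
  have p: "0 \<le> p" "p \<le> 1" using k by (auto simp: p_def)
  have np: "real n * p = real k" using k by (simp add: p_def)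
  have "real (2 * m + 1) / (7 / 3 * real (2 * m + 1))
      \<le> (\<Sum>i\<le>n. of_bool (\<bar>real i - real k\<bar> \<le> real m) * Bernstein n i p)"
  proof (rule discrete_gauss_inequality)
    show "1 + 12 * (\<Sum>i\<le>n. (real i - real k)\<^sup>2 * Bernstein n i p) \<le> (7 / 3 * real (2 * m + 1))\<^sup>2"
      using V Bernstein_second_central_moment[of n p] by (simp only: np V_def)
  qed (use k p Bernstein_unimodal[of k n] in \<open>auto simp: Bernstein_nonneg p_def[symmetric]\<close>)
  also have "\<dots> \<le> (\<Sum>i\<le>n. of_bool (\<bar>real i - real k\<bar> \<le> sqrt V) * Bernstein n i p)"
    using m p by (intro sum_mono mult_right_mono) (auto simp: Bernstein_nonneg)
  also have "\<dots> = one_sd_prob n k"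
    using k by (simp add: one_sd_prob_eq V_def p_def)
  finally have "real (2 * m + 1) / (7 / 3 * real (2 * m + 1)) \<le> one_sd_prob n k" .
  moreover have "real (2 * m + 1) / (7 / 3 * real (2 * m + 1)) = 3 / 7"
    by (simp add: field_simps)
  ultimately show ?thesis by (simp only:)
qed

section \<open>The extremal value is at most 3/7\<close>

text \<open>The quadratic term matters: Bernoulli's inequality would only give
  \<open>(1 + 1 / m) ^ m \<ge> 2\<close>, short of 7/3.\<close>

lemma power_ge_second_order:
  fixes x :: real
  assumes "0 \<le> x"
  shows "1 + real m * x + real m * (real m - 1) / 2 * x\<^sup>2 \<le> (1 + x) ^ m"
proof (induction m)
  case 0
  then show ?case by simp
next
  case (Suc m)
  have "0 \<le> real m * (real m - 1)"
    by (cases m) auto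
  then have "0 \<le> real m * (real m - 1) / 2 * x ^ 3"
    using assms by simp
  then have "1 + real (Suc m) * x + real (Suc m) * (real (Suc m) - 1) / 2 * x\<^sup>2
      \<le> (1 + x) * (1 + real m * x + real m * (real m - 1) / 2 * x\<^sup>2)"
    by (simp add: field_simps power2_eq_square power3_eq_cube)
  also have "\<dots> \<le> (1 + x) * (1 + x) ^ m"
    using Suc.IH assms by (intro mult_left_mono) auto
  finally show ?case by simp
qed

lemma power_ratio_le:
  assumes "4 \<le> n"
  shows "((real n - 1) / real n) ^ (n - 1) \<le> 3 / 7"
proof -
  define m where "m = n - 1"
  have m: "3 \<le> m" "real n = real m + 1" using assms by (auto simp: m_def)
  \<comment> \<open>The right side is \<open>5 / 2 - 1 / (2 * m)\<close>, equal to 7/3 at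
    \<open>m = 3\<close>.\<close>
  have "7 / 3 \<le> 1 + real m * (1 / real m) + real m * (real m - 1) / 2 * (1 / real m)\<^sup>2"
    using m by (simp add: field_simps power2_eq_square)
  also have "\<dots> \<le> (1 + 1 / real m) ^ m"
    by (rule power_ge_second_order) simp
  finally have "inverse ((1 + 1 / real m) ^ m) \<le> inverse (7 / 3)"
    by (intro le_imp_inverse_le) auto
  also have "inverse ((1 + 1 / real m) ^ m) = ((real n - 1) / real n) ^ m"
    using m by (simp add: power_inverse[symmetric] field_simps)
  finally show ?thesis by (simp add: m_def)
qed

theorem theorem1p1:
  fixes n :: nat
  assumes "n \<ge> 1"
  shows "(MIN k\<in>{0..n}. one_sd_prob n k) = one_sd_prob n 1
       \<and> one_sd_prob n 1 = one_sd_prob n (n - 1)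
       \<and> one_sd_prob n (n - 1) =
           (if n = 1 then 1 else ((real n - 1) / real n) ^ (n - 1))"
proof -
  define r where "r = (if n = 1 then 1 else ((real n - 1) / real n) ^ (n - 1))"
  have f1: "one_sd_prob n 1 = r"
  proof (cases "n = 1")
    case True
    then show ?thesis using one_sd_prob_self[of 1] by (simp add: r_def)
  next
    case False
    with assms show ?thesis
      using one_sd_prob_variance_less_1[of 1 n] by (simp add: r_def Bernstein_def field_simps)
  qed
  have fn: "one_sd_prob n (n - 1) = r"
  proof (cases "n = 1")
    case True
    then show ?thesis by (simp add: r_def one_sd_prob_0)
  next
    case False
    moreover have "n choose (n - 1) = n"
      using assms binomial_symmetric[of 1 n] by simp
    ultimately show ?thesis
      using assms one_sd_prob_variance_less_1[of "n - 1" n]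
      by (simp add: r_def Bernstein_def of_nat_diff field_simps)
  qed
  have "r \<le> one_sd_prob n k" if "k \<le> n" for k
  proof -
    have "r \<le> 1"
      using f1 by (metis one_sd_prob_def measure_pmf.prob_le_1)
    \<comment> \<open>The last case forces \<open>n \<ge> 4\<close>, as
      \<open>power_ratio_le\<close> requires.\<close>
    consider "k = 0" | "k = n" | "k = 1" | "k = n - 1" | "2 \<le> k" "k + 2 \<le> n"
      using \<open>k \<le> n\<close> by fastforce
    then show ?thesis
    proof cases
      case 5
      then have "r \<le> 3 / 7"
        using power_ratio_le[of n] by (simp add: r_def)
      also have "\<dots> \<le> one_sd_prob n k"
        using 5 by (rule one_sd_prob_ge)
      finally show ?thesis .
    qed (use f1 fn \<open>r \<le> 1\<close> assms in \<open>auto simp: one_sd_prob_0 one_sd_prob_self\<close>)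
  qed
  then have "(MIN k\<in>{0..n}. one_sd_prob n k) = r"
    using assms f1 by (intro Min_eqI) (auto intro!: image_eqI[of _ _ 1])
  with f1 fn show ?thesis by (simp add: r_def)
qed

end
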